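(* Let $p$ be a real number with $2 \leq p < \infty$, and let $\mathbb{X}$ be the $2$-dimensional real Banach space $l_p^2$. Then $T \in \mathbb{L}(\mathbb{X})$ is left symmetric in $\mathbb{L}(\mathbb{X})$ if and only if $T$ is the zero operator.
   Context: $l_p^2$ is $\mathbb{R}^2$ with the norm $\|(a,b)\| = (|a|^p + |b|^p)^{1/p}$. $\mathbb{L}(\mathbb{X})$ denotes the Banach space of all linear operators on $\mathbb{X}$ with the operator norm. For elements $u, v$ of a real normed linear space, $u$ is Birkhoff-James orthogonal to $v$, written $u \perp_B v$, if $\|u\| \leq \|u + \lambda v\|$ for all $\lambda \in \mathbb{R}$. An operator $T \in \mathbb{L}(\mathbb{X})$ is left symmetric (a left symmetric point of $\mathbb{L}(\mathbb{X})$) if for every $A \in \mathbb{L}(\mathbb{X})$, $T \perp_B A$ implies $A \perp_B T$. *)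

theory Defs
  imports "HOL-Analysis.Analysis"
begin

definition lp_norm :: "real \<Rightarrow> real^2 \<Rightarrow> real" where
  "lp_norm p x = (\<bar>x $ 1\<bar> powr p + \<bar>x $ 2\<bar> powr p) powr (1 / p)"

(* The type (real^2) \<Rightarrow>\<^sub>L (real^2) serves only as the real vector space of all linear
   operators on the plane (in finite dimension every linear map is bounded).
   Its built-in norm is the Euclidean operator norm and is not used: the operator
   norm on l_p^2 is the following one. *)
definition lp_opnorm :: "real \<Rightarrow> ((real^2) \<Rightarrow>\<^sub>L (real^2)) \<Rightarrow> real" where
  "lp_opnorm p T = (SUP x\<in>{x. lp_norm p x = 1}. lp_norm p (blinfun_apply T x))"

(* Since p is a real parameter, the norm cannot come from a type class instance;
   the following notions therefore take the norm N as an argument. *)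
definition bj_orthogonal :: "('a::real_vector \<Rightarrow> real) \<Rightarrow> 'a \<Rightarrow> 'a \<Rightarrow> bool" where
  "bj_orthogonal N u v \<longleftrightarrow> (\<forall>c::real. N u \<le> N (u + c *\<^sub>R v))"

definition left_symmetric :: "('a::real_vector \<Rightarrow> real) \<Rightarrow> 'a \<Rightarrow> bool" where
  "left_symmetric N t \<longleftrightarrow> (\<forall>a. bj_orthogonal N t a \<longrightarrow> bj_orthogonal N a t)"

(* The supremum in lp_opnorm is over a nonempty set that is bounded above, so it is
   not an unspecified value of Sup on the reals. *)
lemma lp_unit_sphere_nonempty:
  assumes "p > 0"
  shows "{x. lp_norm p x = 1} \<noteq> {}"
proof -
  have "lp_norm p (axis 1 1) = 1"
    using assms by (simp add: lp_norm_def axis_def)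
  then show ?thesis by blast
qed

lemma lp_opnorm_bdd_above:
  assumes "p > 0"
  shows "bdd_above ((\<lambda>x. lp_norm p (blinfun_apply T x)) ` {x. lp_norm p x = 1})"
proof (rule bdd_aboveI2)
  fix x :: "real^2"
  assume "x \<in> {x. lp_norm p x = 1}"
  then have "(\<bar>x $ 1\<bar> powr p + \<bar>x $ 2\<bar> powr p) powr (1 / p) = 1"
    by (simp add: lp_norm_def)
  then have "((\<bar>x $ 1\<bar> powr p + \<bar>x $ 2\<bar> powr p) powr (1 / p)) powr p = 1"
    by simp
  then have s: "\<bar>x $ 1\<bar> powr p + \<bar>x $ 2\<bar> powr p = 1"
    using assms by (simp add: powr_powr)
  have c: "\<bar>a\<bar> \<le> 1" if "\<bar>a\<bar> powr p \<le> 1" for a :: real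
    using that assms gr_one_powr[of "\<bar>a\<bar>" p] by linarith
  have "\<bar>x $ 1\<bar> \<le> 1" "\<bar>x $ 2\<bar> \<le> 1"
    using s powr_ge_zero[of "\<bar>x $ 1\<bar>" p] powr_ge_zero[of "\<bar>x $ 2\<bar>" p]
    by (auto intro!: c simp del: powr_ge_zero)
  then have "norm x \<le> 2"
    using norm_le_l1_cart[of x] by (simp add: sum_2)
  then have nT: "norm (blinfun_apply T x) \<le> norm T * 2"
    using norm_blinfun[of T x] mult_left_mono[of "norm x" 2 "norm T"] by simp
  have *: "\<bar>blinfun_apply T x $ i\<bar> powr p \<le> (norm T * 2) powr p" for i
    using component_le_norm_cart[of "blinfun_apply T x" i] nT assms
    by (intro powr_mono2) auto
  then show "lp_norm p (blinfun_apply T x)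
      \<le> ((norm T * 2) powr p + (norm T * 2) powr p) powr (1 / p)"
    unfolding lp_norm_def using assms by (intro powr_mono2[of "1 / p"] add_nonneg_nonneg add_mono *) simp_all
qed

end

theory Submission
  imports Defs
begin

text \<open>Let \<open>\<Psi>(w) = \<bar>w\<^sub>1\<bar>\<^sup>p + \<bar>w\<^sub>2\<bar>\<^sup>p\<close> be the \<open>p\<close>-th power of the norm and \<open>\<phi>(w)\<close> its gradient divided by \<open>p\<close>;
thus \<open>\<phi>(w) \<bullet> d = 0\<close> says that \<open>w\<close> is Birkhoff-James orthogonal to \<open>d\<close>. The geometry of the plane
enters only through the strict tangent inequality \<open>\<Psi>(w) + p \<phi>(w) \<bullet> d < \<Psi>(w + d)\<close> for \<open>d \<noteq> 0\<close>,
the continuity of \<open>\<phi>\<close>, and compactness of the unit sphere. Orthogonality of operators is accessed through the points at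
which an operator attains its norm (norming points). If \<open>\<phi>(T x) \<bullet> A x = 0\<close> at one norming
point \<open>x\<close> of \<open>T\<close>, then \<open>T\<close> is orthogonal to \<open>A\<close>. Conversely, if \<open>A\<close> is orthogonal to \<open>T\<close>, then
\<open>\<phi>(A y) \<bullet> T y \<ge> 0\<close> at some norming point \<open>y\<close> of \<open>A\<close>, and \<open>\<phi>(A y') \<bullet> T y' \<le> 0\<close> at some
norming point \<open>y'\<close> of \<open>A\<close>.

Suppose that \<open>T \<noteq> 0\<close> is left symmetric and attains its norm at \<open>x\<close>. Three test operators \<open>A\<close>, each
with \<open>\<phi>(T x) \<bullet> A x = 0\<close>, lead to a contradiction.

Choose a unit vector \<open>z\<close> with \<open>\<phi>(z) \<bullet> x = 0\<close>. The operator \<open>A y = (\<phi>(z) \<bullet> y) T z\<close> kills \<open>x\<close>, and by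
strict convexity it attains its norm only at \<open>\<plusminus>z\<close>, where it coincides with \<open>T\<close>; so it can be
orthogonal to \<open>T\<close> only if \<open>T z = 0\<close>. As \<open>x\<close> is a norming point, \<open>T z = 0\<close> forces
\<open>\<phi>(x) \<bullet> z = 0\<close> as well. Hence \<open>x\<close> and \<open>z\<close> are mutually orthogonal, every \<open>y\<close> is
\<open>g(y) x + h(y) z\<close> with \<open>g = \<phi>(x)\<close> and \<open>h = \<phi>(z)\<close>, and \<open>T y = g(y) u\<close> with \<open>u = T x\<close>.

Choose \<open>v \<noteq> 0\<close> with \<open>\<phi>(u) \<bullet> v = 0\<close>. The operator \<open>A y = g(y) v\<close> shows that \<open>\<phi>(v) \<bullet> u = 0\<close> too.

Finally let \<open>A y = (g(y) + h(y)) v + \<epsilon> h(y) u\<close> with a small \<open>\<epsilon> > 0\<close>. Orthogonality of \<open>v\<close> to \<open>u\<close>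
makes \<open>\<phi>(A y) \<bullet> u\<close> have the sign of \<open>h(y)\<close>. So if \<open>A\<close> is orthogonal to \<open>T\<close>, it has a norming point
with \<open>g(y) h(y) \<le> 0\<close>. There \<open>\<bar>g(y) + h(y)\<bar> \<le> 1\<close>, and the norm of \<open>A y\<close> hardly exceeds that of \<open>v\<close>.
But \<open>x + \<eta> z\<close> with a small \<open>\<eta> > 0\<close> has norm less than \<open>1 + \<eta>\<close>, since \<open>x\<close> is orthogonal to \<open>z\<close>; so
the functional \<open>g + h\<close> has norm greater than \<open>1\<close>, and \<open>A\<close> does better at \<open>x + \<eta> z\<close>. This is the
contradiction; the lemma \<open>left_symmetric_imp_zero\<close> assembles it.\<close>

section \<open>The power of the norm, its gradient and strict convexity\<close>
definition lp_pow :: "real \<Rightarrow> real^2 \<Rightarrow> real" where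
  "lp_pow p w = \<bar>w $ 1\<bar> powr p + \<bar>w $ 2\<bar> powr p"

text \<open>The gradient of \<open>lp_pow p\<close> at \<open>w\<close>, divided by \<open>p\<close>: the duality map of the \<open>l\<^sub>p\<close> plane. Its coordinates vanish with those of \<open>w\<close> because \<open>sgn 0 = 0\<close>.\<close>
definition lp_dual :: "real \<Rightarrow> real^2 \<Rightarrow> real^2" where
  "lp_dual p w = (\<chi> i. sgn (w $ i) * \<bar>w $ i\<bar> powr (p - 1))"

lemma lp_dual_inner:
  "lp_dual p w \<bullet> d = sgn (w $ 1) * \<bar>w $ 1\<bar> powr (p - 1) * d $ 1 + sgn (w $ 2) * \<bar>w $ 2\<bar> powr (p - 1) * d $ 2"
  by (simp add: lp_dual_def inner_vec_def sum_2)

lemma bernoulli_powr_strict: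
  fixes p r :: real
  assumes p: "1 < p" and r: "0 < r" "r \<noteq> 1"
  shows "1 + p * (r - 1) < r powr p"
proof -
  have der: "((\<lambda>x. x powr p) has_real_derivative p * x powr (p - 1)) (at x)" if "x > 0" for x :: real
    using that by (auto intro!: derivative_eq_intros)
  consider "r < 1" | "1 < r" using r by linarith
  then show ?thesis
  proof cases
    case 1
    obtain x where x: "r < x" "x < 1" "1 powr p - r powr p = (1 - r) * (p * x powr (p - 1))"
      using MVT2[of r 1 "\<lambda>x. x powr p" "\<lambda>x. p * x powr (p - 1)"] der r 1 by force
    have "x powr (p - 1) < 1"
      using x r p powr_less_mono2[of "p - 1" x 1] by simp
    then have "(1 - r) * (p * x powr (p - 1)) < (1 - r) * (p * 1)"
      using 1 p by (intro mult_strict_left_mono) auto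
    with x(3) show ?thesis by (simp add: algebra_simps)
  next
    case 2
    obtain x where x: "1 < x" "x < r" "r powr p - 1 powr p = (r - 1) * (p * x powr (p - 1))"
      using MVT2[of 1 r "\<lambda>x. x powr p" "\<lambda>x. p * x powr (p - 1)"] der 2 by force
    have "1 < x powr (p - 1)"
      using x r p powr_less_mono2[of "p - 1" 1 x] by simp
    then have "(r - 1) * (p * 1) < (r - 1) * (p * x powr (p - 1))"
      using 2 p by (intro mult_strict_left_mono) auto
    with x(3) show ?thesis by (simp add: algebra_simps)
  qed
qed

text \<open>The graph of \<open>\<lambda>b. \<bar>b\<bar> powr p\<close> lies strictly above its tangent at \<open>a\<close>. For \<open>a > 0\<close> and \<open>b > 0\<close> this is the Bernoulli inequality for \<open>b / a\<close>; for \<open>b \<le> 0\<close> the tangent is already negative. The case \<open>a < 0\<close> is the mirror image, and at \<open>a = 0\<close> the tangent is the zero line.\<close>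
lemma abs_powr_tangent_strict:
  fixes p a b :: real
  assumes p: "1 < p" and ne: "b \<noteq> a"
  shows "\<bar>a\<bar> powr p + p * (sgn a * \<bar>a\<bar> powr (p - 1) * (b - a)) < \<bar>b\<bar> powr p"
proof -
  have pos: "\<bar>a\<bar> powr p + p * (\<bar>a\<bar> powr (p - 1) * (b - a)) < \<bar>b\<bar> powr p"
    if a: "0 < a" and ne: "b \<noteq> a" for a b :: real
  proof -
    have split: "a powr p = a * a powr (p - 1)"
      using a powr_mult_base[of a "p - 1"] by simp
    show ?thesis
    proof (cases "0 < b")
      case True
      have "1 + p * (b / a - 1) < (b / a) powr p"
        using True a ne p by (intro bernoulli_powr_strict) auto
      then have "(1 + p * (b / a - 1)) * a powr p < (b / a) powr p * a powr p"
        using a by (intro mult_strict_right_mono) auto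
      also have "(b / a) powr p * a powr p = b powr p"
        using True a by (simp add: powr_divide)
      also have "(1 + p * (b / a - 1)) * a powr p = a powr p + p * (a powr (p - 1) * (b - a))"
        unfolding split using a by (simp add: field_simps)
      finally show ?thesis using a True by simp
    next
      case False
      have "p * b \<le> 0" using p False by (simp add: mult_nonneg_nonpos)
      moreover have "a < p * a" using p a by simp
      ultimately have "a + p * (b - a) < 0" by (simp add: algebra_simps)
      then have "a powr (p - 1) * (a + p * (b - a)) < 0"
        using a by (intro mult_pos_neg) auto
      also have "0 \<le> \<bar>b\<bar> powr p" by simp
      finally show ?thesis using a by (simp add: algebra_simps split)
    qed
  qed
  consider "0 < a" | "a = 0" | "a < 0" by linarith
  then show ?thesis
  proof cases
    case 1 then show ?thesis using pos[OF 1 ne] by simp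
  next
    case 2 then show ?thesis using ne by simp
  next
    case 3 then show ?thesis using pos[of "- a" "- b"] ne by (simp add: algebra_simps)
  qed
qed

lemma lp_pow_tangent_strict:
  assumes p: "1 < p" and d: "d \<noteq> 0"
  shows "lp_pow p w + p * (lp_dual p w \<bullet> d) < lp_pow p (w + d)"
proof -
  have le: "\<bar>w $ i\<bar> powr p + p * (sgn (w $ i) * \<bar>w $ i\<bar> powr (p - 1) * d $ i) \<le> \<bar>(w + d) $ i\<bar> powr p" for i
    using abs_powr_tangent_strict[OF p, of "(w + d) $ i" "w $ i"] by (cases "d $ i = 0") auto
  have lt: "\<bar>w $ i\<bar> powr p + p * (sgn (w $ i) * \<bar>w $ i\<bar> powr (p - 1) * d $ i) < \<bar>(w + d) $ i\<bar> powr p"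
    if "d $ i \<noteq> 0" for i
    using abs_powr_tangent_strict[OF p, of "(w + d) $ i" "w $ i"] that by auto
  have "d $ 1 \<noteq> 0 \<or> d $ 2 \<noteq> 0"
    using d by (auto simp: vec_eq_iff forall_2)
  then show ?thesis
    using le[of 1] le[of 2] lt[of 1] lt[of 2]
    unfolding lp_pow_def lp_dual_inner distrib_left by linarith
qed

lemma lp_pow_tangent:
  assumes "1 < p"
  shows "lp_pow p w + p * (lp_dual p w \<bullet> d) \<le> lp_pow p (w + d)"
  using lp_pow_tangent_strict[OF assms, of d w] by (cases "d = 0") auto

text \<open>The tangent inequality at \<open>w + d\<close>, read backwards. Together with continuity of the gradient it replaces differentiability of \<open>lp_pow\<close>.\<close>
lemma lp_pow_tangent_above:
  assumes "1 < p"
  shows "lp_pow p (w + d) \<le> lp_pow p w + p * (lp_dual p (w + d) \<bullet> d)"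
  using lp_pow_tangent[OF assms, of "w + d" "- d"] by simp

lemma lp_pow_scaleR: "lp_pow p (c *\<^sub>R w) = \<bar>c\<bar> powr p * lp_pow p w"
  by (simp add: lp_pow_def abs_mult powr_mult algebra_simps)

lemma lp_dual_scaleR: "lp_dual p (c *\<^sub>R w) = (sgn c * \<bar>c\<bar> powr (p - 1)) *\<^sub>R lp_dual p w"
  by (simp add: lp_dual_def vec_eq_iff abs_mult powr_mult sgn_mult)

lemma sgn_abs_powr_mult_self: "sgn a * \<bar>a\<bar> powr (p - 1) * a = \<bar>a\<bar> powr p" for a :: real
  using powr_mult_base[of "\<bar>a\<bar>" "p - 1"] by (cases a "0::real" rule: linorder_cases) (auto simp: mult_ac)

lemma lp_dual_scaleR_inner_scaleR:
  "lp_dual p (c *\<^sub>R v) \<bullet> (c *\<^sub>R u) = \<bar>c\<bar> powr p * (lp_dual p v \<bullet> u)"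
  using sgn_abs_powr_mult_self[of c p, symmetric] by (simp add: lp_dual_scaleR mult_ac)

lemma lp_dual_inner_self: "lp_dual p w \<bullet> w = lp_pow p w"
  by (simp add: lp_dual_inner lp_pow_def sgn_abs_powr_mult_self)

lemma lp_pow_nonneg: "0 \<le> lp_pow p w"
  by (simp add: lp_pow_def)

lemma lp_pow_pos:
  assumes "w \<noteq> 0" shows "0 < lp_pow p w"
proof -
  have "w $ 1 \<noteq> 0 \<or> w $ 2 \<noteq> 0"
    using assms by (auto simp: vec_eq_iff forall_2)
  then show ?thesis
    by (auto simp: lp_pow_def intro: add_pos_nonneg add_nonneg_pos)
qed

lemma lp_pow_zero [simp]: "lp_pow p 0 = 0"
  by (simp add: lp_pow_def)

lemma lp_norm_eq: "lp_norm p w = lp_pow p w powr (1 / p)"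
  by (simp add: lp_norm_def lp_pow_def)

lemma lp_norm_le_iff:
  assumes "1 < p"
  shows "lp_norm p v \<le> lp_norm p w \<longleftrightarrow> lp_pow p v \<le> lp_pow p w"
  using assms powr_mono2[of "1 / p" "lp_pow p v" "lp_pow p w"]
    powr_less_mono2[of "1 / p" "lp_pow p w" "lp_pow p v"] lp_pow_nonneg[of p v] lp_pow_nonneg[of p w]
  by (cases "lp_pow p v \<le> lp_pow p w") (auto simp: lp_norm_eq)

lemma lp_norm_eq_1_iff:
  assumes "1 < p"
  shows "lp_norm p w = 1 \<longleftrightarrow> lp_pow p w = 1"
proof
  assume "lp_norm p w = 1"
  then have "lp_norm p w powr p = 1" by simp
  then show "lp_pow p w = 1"
    using assms by (simp add: lp_norm_eq powr_powr lp_pow_nonneg)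
qed (simp add: lp_norm_eq)

lemma continuous_on_lp_pow [continuous_intros]:
  assumes "1 < p" "continuous_on S f"
  shows "continuous_on S (\<lambda>x. lp_pow p (f x))"
  unfolding lp_pow_def using assms(1)
  by (intro continuous_intros continuous_on_powr' assms(2)) auto

lemma continuous_on_lp_dual [continuous_intros]:
  assumes "1 < p" "continuous_on S f"
  shows "continuous_on S (\<lambda>x. lp_dual p (f x))"
proof -
  \<comment> \<open>The form on the right avoids the jump of \<open>sgn\<close> and is visibly continuous.\<close>
  have eq: "sgn a * \<bar>a\<bar> powr (p - 1) = max a 0 powr (p - 1) - max (- a) 0 powr (p - 1)" for a :: real
    by (auto simp: sgn_if max_def)
  show ?thesis
    unfolding lp_dual_def eq using assms(1)
    by (intro continuous_intros continuous_on_powr' assms(2)) auto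
qed

lemma lp_dual_at_right:
  assumes "1 < p"
  shows "((\<lambda>c. lp_dual p (w + c *\<^sub>R d) \<bullet> d) \<longlongrightarrow> lp_dual p w \<bullet> d) (at_right 0)"
proof -
  have "continuous_on UNIV (\<lambda>c. lp_dual p (w + c *\<^sub>R d) \<bullet> d)"
    by (intro continuous_intros assms)
  then have "isCont (\<lambda>c. lp_dual p (w + c *\<^sub>R d) \<bullet> d) 0"
    by (simp add: continuous_on_eq_continuous_at)
  then show ?thesis
    by (simp add: isCont_def filterlim_at_split)
qed

lemma lp_pow_normalize:
  assumes "1 < p" "w \<noteq> 0"
  obtains k where "0 < k" "lp_pow p (k *\<^sub>R w) = 1" "\<bar>k\<bar> powr p = 1 / lp_pow p w"
proof
  have "\<bar>lp_pow p w powr (- 1 / p)\<bar> powr p = 1 / lp_pow p w"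
    unfolding abs_of_nonneg[OF powr_ge_zero] powr_powr
    using assms lp_pow_pos[of w p] by (simp add: powr_minus_divide)
  then show "\<bar>lp_pow p w powr (- 1 / p)\<bar> powr p = 1 / lp_pow p w"
    "lp_pow p (lp_pow p w powr (- 1 / p) *\<^sub>R w) = 1"
    using lp_pow_pos[OF assms(2), of p] by (simp_all add: lp_pow_scaleR)
  show "0 < lp_pow p w powr (- 1 / p)"
    using lp_pow_pos[OF assms(2), of p] by simp
qed

section \<open>Norming points of operators\<close>
lemma compact_lp_sphere:
  assumes "1 < p"
  shows "compact {w. lp_pow p w = 1}"
proof -
  have "closed {w. lp_pow p w = 1}"
    by (intro closed_Collect_eq continuous_intros assms)
  moreover have "bounded {w. lp_pow p w = 1}"
  proof (rule boundedI)
    fix w assume "w \<in> {w. lp_pow p w = 1}"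
    then have s: "\<bar>w $ 1\<bar> powr p + \<bar>w $ 2\<bar> powr p = 1"
      by (simp add: lp_pow_def)
    have le: "\<bar>a\<bar> \<le> 1" if "\<bar>a\<bar> powr p \<le> 1" for a :: real
      using that assms gr_one_powr[of "\<bar>a\<bar>" p] by linarith
    have "\<bar>w $ 1\<bar> \<le> 1" "\<bar>w $ 2\<bar> \<le> 1"
      using s powr_ge_zero[of "\<bar>w $ 1\<bar>" p] powr_ge_zero[of "\<bar>w $ 2\<bar>" p] by (intro le; linarith)+
    then show "norm w \<le> 2"
      using norm_le_l1_cart[of w] by (simp add: sum_2)
  qed
  ultimately show ?thesis by (simp add: compact_eq_bounded_closed)
qed

text \<open>The points of the unit sphere at which \<open>T\<close> attains its operator norm, expressed without roots.\<close>
definition lp_norming :: "real \<Rightarrow> ((real^2) \<Rightarrow>\<^sub>L (real^2)) \<Rightarrow> real^2 \<Rightarrow> bool" where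
  "lp_norming p T x \<longleftrightarrow> lp_pow p x = 1 \<and> (\<forall>y. lp_pow p y = 1 \<longrightarrow> lp_pow p (T y) \<le> lp_pow p (T x))"

lemma lp_norming_exists:
  fixes T :: "(real^2) \<Rightarrow>\<^sub>L (real^2)"
  assumes p: "1 < p"
  shows "\<exists>x. lp_norming p T x"
proof -
  have "{w. lp_pow p w = 1} \<noteq> {}"
    using lp_unit_sphere_nonempty[of p] p by (simp add: lp_norm_eq_1_iff)
  moreover have "continuous_on {w. lp_pow p w = 1} (\<lambda>w. lp_pow p (T w))"
    by (intro continuous_intros p)
  ultimately show ?thesis
    using continuous_attains_sup[OF compact_lp_sphere[OF p], of "\<lambda>w. lp_pow p (T w)"]
    by (auto simp: lp_norming_def)
qed

lemma lp_norming_bound: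
  fixes T :: "(real^2) \<Rightarrow>\<^sub>L (real^2)"
  assumes p: "1 < p" and x: "lp_norming p T x"
  shows "lp_pow p (T y) \<le> lp_pow p (T x) * lp_pow p y"
proof (cases "y = 0")
  case False
  obtain k where k: "0 < k" "lp_pow p (k *\<^sub>R y) = 1" "\<bar>k\<bar> powr p = 1 / lp_pow p y"
    using lp_pow_normalize[OF p False] .
  have "lp_pow p (T (k *\<^sub>R y)) \<le> lp_pow p (T x)"
    using x k(2) by (simp add: lp_norming_def)
  then have "\<bar>k\<bar> powr p * lp_pow p (T y) \<le> lp_pow p (T x)"
    by (simp add: blinfun.scaleR_right lp_pow_scaleR)
  then show ?thesis
    using lp_pow_pos[OF False, of p] unfolding k(3) by (simp add: field_simps)
qed (simp add: blinfun.zero_right)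

lemma lp_opnorm_norming:
  fixes T :: "(real^2) \<Rightarrow>\<^sub>L (real^2)"
  assumes p: "1 < p" and x: "lp_norming p T x"
  shows "lp_opnorm p T = lp_norm p (T x)"
  unfolding lp_opnorm_def
proof (rule cSup_eq_maximum)
  show "lp_norm p (T x) \<in> (\<lambda>x. lp_norm p (T x)) ` {x. lp_norm p x = 1}"
    using x p by (auto simp: lp_norming_def lp_norm_eq_1_iff)
next
  fix s assume "s \<in> (\<lambda>x. lp_norm p (T x)) ` {x. lp_norm p x = 1}"
  then show "s \<le> lp_norm p (T x)"
    using x p by (auto simp: lp_norming_def lp_norm_eq_1_iff lp_norm_le_iff)
qed

lemma lp_opnorm_upper:
  fixes T :: "(real^2) \<Rightarrow>\<^sub>L (real^2)"
  assumes p: "1 < p" and y: "lp_pow p y = 1"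
  shows "lp_norm p (T y) \<le> lp_opnorm p T"
proof -
  obtain x where x: "lp_norming p T x" using lp_norming_exists[OF p] by blast
  then show ?thesis
    using y p by (simp add: lp_opnorm_norming[OF p x] lp_norm_le_iff lp_norming_def)
qed

section \<open>Birkhoff-James orthogonality of operators\<close>
text \<open>The operator norm of \<open>T + c A\<close> is at least its value at \<open>x\<close>, and there the tangent inequality shows that moving along \<open>A x\<close> cannot decrease the norm of \<open>T x\<close>.\<close>
lemma bj_orthogonalI_norming:
  fixes T A :: "(real^2) \<Rightarrow>\<^sub>L (real^2)"
  assumes p: "1 < p" and x: "lp_norming p T x" and orth: "lp_dual p (T x) \<bullet> A x = 0"
  shows "bj_orthogonal (lp_opnorm p) T A"
  unfolding bj_orthogonal_def
proof
  fix c :: real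
  have "lp_pow p (T x) \<le> lp_pow p (T x + c *\<^sub>R A x)"
    using lp_pow_tangent[OF p, of "T x" "c *\<^sub>R A x"] orth by simp
  then have "lp_norm p (T x) \<le> lp_norm p ((T + c *\<^sub>R A) x)"
    using p by (simp add: lp_norm_le_iff blinfun.add_left blinfun.scaleR_left)
  also have "\<dots> \<le> lp_opnorm p (T + c *\<^sub>R A)"
    using x by (intro lp_opnorm_upper p) (simp add: lp_norming_def)
  finally show "lp_opnorm p T \<le> lp_opnorm p (T + c *\<^sub>R A)"
    by (simp add: lp_opnorm_norming[OF p x])
qed

text \<open>Take a norming point \<open>Y\<close> of \<open>A + c T\<close> for \<open>c > 0\<close>. Orthogonality of \<open>A\<close> to \<open>T\<close> says that its value is
at least the norm of \<open>A\<close>, hence at least the value of \<open>A\<close> at \<open>Y\<close>; by convexity the slope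
\<open>lp_dual p (A Y + c *\<^sub>R T Y) \<bullet> T Y\<close> at the far end is nonnegative. A limit of such points as \<open>c\<close> tends to \<open>0\<close>
is a norming point of \<open>A\<close>, and the sign survives.\<close>
lemma bj_orthogonalD_norming:
  fixes T A :: "(real^2) \<Rightarrow>\<^sub>L (real^2)"
  assumes p: "1 < p" and bj: "bj_orthogonal (lp_opnorm p) A T"
  obtains y where "lp_norming p A y" "0 \<le> lp_dual p (A y) \<bullet> T y"
proof -
  define c :: "nat \<Rightarrow> real" where "c n = inverse (real (Suc n))" for n
  have c: "0 < c n" for n by (simp add: c_def)
  have c0: "c \<longlonglongrightarrow> 0" unfolding c_def by (rule LIMSEQ_inverse_real_of_nat)
  have "\<exists>y. lp_norming p (A + c n *\<^sub>R T) y" for n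
    by (rule lp_norming_exists[OF p])
  then obtain Y where Y: "\<And>n. lp_norming p (A + c n *\<^sub>R T) (Y n)" by metis
  have S: "lp_pow p (Y n) = 1" for n using Y by (simp add: lp_norming_def)
  have ge: "lp_pow p (A w) \<le> lp_pow p (A (Y n) + c n *\<^sub>R T (Y n))" if "lp_pow p w = 1" for n w
  proof -
    have "lp_norm p (A w) \<le> lp_opnorm p A" by (rule lp_opnorm_upper[OF p that])
    also have "\<dots> \<le> lp_opnorm p (A + c n *\<^sub>R T)"
      using bj by (simp add: bj_orthogonal_def)
    also have "\<dots> = lp_norm p ((A + c n *\<^sub>R T) (Y n))"
      by (rule lp_opnorm_norming[OF p Y])
    finally show ?thesis
      using p by (simp add: lp_norm_le_iff blinfun.add_left blinfun.scaleR_left)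
  qed
  have sgn: "0 \<le> lp_dual p (A (Y n) + c n *\<^sub>R T (Y n)) \<bullet> T (Y n)" for n
  proof -
    have "0 \<le> p * (c n * (lp_dual p (A (Y n) + c n *\<^sub>R T (Y n)) \<bullet> T (Y n)))"
      using lp_pow_tangent_above[OF p, of "A (Y n)" "c n *\<^sub>R T (Y n)"] ge[OF S, of n n] by simp
    then show ?thesis using p c[of n] by (simp add: zero_le_mult_iff)
  qed
  obtain y r where r: "strict_mono r" and y: "lp_pow p y = 1" and lim: "(Y \<circ> r) \<longlonglongrightarrow> y"
    using compact_lp_sphere[OF p] S unfolding compact_def by blast
  have lim': "(\<lambda>n. Y (r n)) \<longlonglongrightarrow> y" using lim by (simp add: o_def)
  have cr: "(\<lambda>n. c (r n)) \<longlonglongrightarrow> 0"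
    using LIMSEQ_subseq_LIMSEQ[OF c0 r] by (simp add: o_def)
  have w: "(\<lambda>n. A (Y (r n)) + c (r n) *\<^sub>R T (Y (r n))) \<longlonglongrightarrow> A y + 0 *\<^sub>R T y"
    by (intro tendsto_intros lim' cr)
  have t1: "(\<lambda>n. lp_pow p (A (Y (r n)) + c (r n) *\<^sub>R T (Y (r n)))) \<longlonglongrightarrow> lp_pow p (A y)"
    using continuous_on_tendsto_compose[OF continuous_on_lp_pow[OF p continuous_on_id, of UNIV] w] by simp
  have t2: "(\<lambda>n. lp_dual p (A (Y (r n)) + c (r n) *\<^sub>R T (Y (r n))) \<bullet> T (Y (r n))) \<longlonglongrightarrow> lp_dual p (A y) \<bullet> T y"
    using continuous_on_tendsto_compose[OF continuous_on_lp_dual[OF p continuous_on_id, of UNIV] w]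
    by (intro tendsto_intros lim') simp
  show ?thesis
  proof (rule that)
    show "lp_norming p A y"
      unfolding lp_norming_def using y t1 ge by (auto intro!: LIMSEQ_le_const)
    show "0 \<le> lp_dual p (A y) \<bullet> T y"
      using sgn by (intro LIMSEQ_le_const[OF t2]) auto
  qed
qed

text \<open>Orthogonality is insensitive to the sign of \<open>T\<close>; the norming point obtained for \<open>- T\<close> may differ from the one for \<open>T\<close>.\<close>
lemma bj_orthogonalD_norming':
  fixes T A :: "(real^2) \<Rightarrow>\<^sub>L (real^2)"
  assumes p: "1 < p" and bj: "bj_orthogonal (lp_opnorm p) A T"
  obtains y where "lp_norming p A y" "lp_dual p (A y) \<bullet> T y \<le> 0"
proof -
  have "bj_orthogonal (lp_opnorm p) A (- T)"
    using bj unfolding bj_orthogonal_def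
    by (metis scaleR_minus_left scaleR_minus_right)
  from bj_orthogonalD_norming[OF p this] show ?thesis
    using that by (auto simp: blinfun.minus_left)
qed

section \<open>Orthogonal vectors in the plane\<close>
lemma lp_left_orthogonal_exists:
  assumes p: "1 < p" and x: "x \<noteq> 0"
  obtains z where "lp_pow p z = 1" "lp_dual p z \<bullet> x = 0"
proof -
  \<comment> \<open>The function \<open>s\<close> inverts the coordinate function of \<open>lp_dual\<close>, so \<open>lp_dual p z0\<close> is \<open>x\<close> rotated by a right angle.\<close>
  define s where "s a = sgn a * \<bar>a\<bar> powr (1 / (p - 1))" for a :: real
  have s: "sgn (s a) * \<bar>s a\<bar> powr (p - 1) = a" for a
    using p by (simp add: s_def sgn_mult abs_mult powr_mult powr_powr sgn_mult_abs)
  define z0 :: "real^2" where "z0 = vector [s (- x $ 2), s (x $ 1)]"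
  have orth: "lp_dual p z0 \<bullet> x = 0"
    unfolding lp_dual_inner z0_def vector_2 s by simp
  have "x $ 1 \<noteq> 0 \<or> x $ 2 \<noteq> 0"
    using x by (auto simp: vec_eq_iff forall_2)
  then have "z0 \<noteq> 0"
    by (auto simp: z0_def vec_eq_iff forall_2 vector_2 s_def sgn_if)
  then obtain k where "0 < k" "lp_pow p (k *\<^sub>R z0) = 1"
    using lp_pow_normalize[OF p] by metis
  with orth show ?thesis by (intro that[of "k *\<^sub>R z0"]) (auto simp: lp_dual_scaleR)
qed

lemma lp_right_orthogonal_exists:
  assumes "u \<noteq> 0"
  obtains v where "v \<noteq> 0" "lp_dual p u \<bullet> v = 0"
proof -
  have "u $ 1 \<noteq> 0 \<or> u $ 2 \<noteq> 0"
    using assms by (auto simp: vec_eq_iff forall_2)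
  then have "vector [- lp_dual p u $ 2, lp_dual p u $ 1] \<noteq> (0 :: real^2)"
    by (auto simp: vec_eq_iff forall_2 vector_2 lp_dual_def sgn_if)
  then show ?thesis
    by (rule that) (simp add: inner_vec_def sum_2 vector_2)
qed

text \<open>A minimum on a line is a critical point: the slope is nonnegative on one side of it by convexity, nonpositive on the other, and continuous.\<close>
lemma lp_dual_orthogonalI:
  assumes p: "1 < p" and min: "\<And>c. lp_pow p w \<le> lp_pow p (w + c *\<^sub>R d)"
  shows "lp_dual p w \<bullet> d = 0"
proof -
  have ge: "0 \<le> lp_dual p w \<bullet> d" if min: "\<And>c. lp_pow p w \<le> lp_pow p (w + c *\<^sub>R d)" for d
  proof -
    have pos: "0 \<le> lp_dual p (w + c *\<^sub>R d) \<bullet> d" if "0 < c" for c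
    proof -
      have "0 \<le> p * (c * (lp_dual p (w + c *\<^sub>R d) \<bullet> d))"
        using lp_pow_tangent_above[OF p, of w "c *\<^sub>R d"] min[of c] by simp
      then show ?thesis using p that by (simp add: zero_le_mult_iff)
    qed
    have "\<forall>\<^sub>F c in at_right 0. 0 \<le> lp_dual p (w + c *\<^sub>R d) \<bullet> d"
      using eventually_at_right_less by (rule eventually_mono) (rule pos)
    then show ?thesis
      by (rule tendsto_lowerbound[OF lp_dual_at_right[OF p]]) simp
  qed
  have "0 \<le> lp_dual p w \<bullet> d" "0 \<le> lp_dual p w \<bullet> (- d)"
    using min[of "- c" for c] by (intro ge min; simp)+
  then show ?thesis by simp
qed


lemma plane_kernel_parallel:
  fixes f x y :: "real^2"
  assumes "f \<noteq> 0" "x \<noteq> 0" "f \<bullet> x = 0" "f \<bullet> y = 0"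
  obtains d where "y = d *\<^sub>R x"
proof -
  have x: "f $ 1 * x $ 1 + f $ 2 * x $ 2 = 0" and y: "f $ 1 * y $ 1 + f $ 2 * y $ 2 = 0"
    using assms by (simp_all add: inner_vec_def sum_2)
  have "f $ i * (x $ 1 * y $ 2 - x $ 2 * y $ 1) = 0" for i
  proof -
    consider "i = 1" | "i = 2" using exhaust_2[of i] by blast
    then show ?thesis
    proof cases
      case 1
      have "f $ 1 * (x $ 1 * y $ 2 - x $ 2 * y $ 1) = 0" using x y by algebra
      then show ?thesis using 1 by simp
    next
      case 2
      have "f $ 2 * (x $ 1 * y $ 2 - x $ 2 * y $ 1) = 0" using x y by algebra
      then show ?thesis using 2 by simp
    qed
  qed
  moreover have "f $ 1 \<noteq> 0 \<or> f $ 2 \<noteq> 0"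
    using assms(1) by (auto simp: vec_eq_iff forall_2)
  ultimately have det: "x $ 1 * y $ 2 = x $ 2 * y $ 1"
    by (metis mult_eq_0_iff eq_iff_diff_eq_0)
  show ?thesis
  proof (cases "x $ 1 = 0")
    case True
    then have "x $ 2 \<noteq> 0" using assms(2) by (auto simp: vec_eq_iff forall_2)
    with True det show ?thesis
      by (intro that[of "y $ 2 / x $ 2"]) (auto simp: vec_eq_iff forall_2)
  next
    case False
    with det show ?thesis
      by (intro that[of "y $ 1 / x $ 1"]) (auto simp: vec_eq_iff forall_2 field_simps)
  qed
qed

lemma left_orthogonal_decomposition:
  assumes "lp_pow p z = 1" "x \<noteq> 0" "lp_dual p z \<bullet> x = 0"
  obtains d where "y = (lp_dual p z \<bullet> y) *\<^sub>R z + d *\<^sub>R x"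
proof -
  have z: "lp_dual p z \<bullet> z = 1" using assms(1) by (simp add: lp_dual_inner_self)
  then have "lp_dual p z \<noteq> 0" by auto
  moreover have "lp_dual p z \<bullet> (y - (lp_dual p z \<bullet> y) *\<^sub>R z) = 0"
    using z by (simp add: inner_diff_right)
  ultimately obtain d where "y - (lp_dual p z \<bullet> y) *\<^sub>R z = d *\<^sub>R x"
    using plane_kernel_parallel assms(2,3) by metis
  then show ?thesis by (intro that[of d]) (simp add: algebra_simps)
qed

text \<open>If \<open>v\<close> is orthogonal to \<open>u\<close>, then \<open>lp_pow\<close> restricted to the line \<open>c v + \<real> u\<close> is strictly convex with its minimum at \<open>c v\<close>, so its slope has the sign of the displacement.\<close>
lemma lp_dual_orthogonal_sign:
  assumes p: "1 < p" and u: "u \<noteq> 0" and vu: "lp_dual p v \<bullet> u = 0" and d: "d \<noteq> 0"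
  shows "0 < d * (lp_dual p (c *\<^sub>R v + d *\<^sub>R u) \<bullet> u)"
proof -
  have "lp_pow p (c *\<^sub>R v) < lp_pow p (c *\<^sub>R v + d *\<^sub>R u)"
    using lp_pow_tangent_strict[OF p, of "d *\<^sub>R u" "c *\<^sub>R v"] u d vu by (simp add: lp_dual_scaleR)
  also have "\<dots> \<le> lp_pow p (c *\<^sub>R v) + p * (d * (lp_dual p (c *\<^sub>R v + d *\<^sub>R u) \<bullet> u))"
    using lp_pow_tangent_above[OF p, of "c *\<^sub>R v" "d *\<^sub>R u"] by simp
  finally show ?thesis using p by (simp add: zero_less_mult_iff)
qed

text \<open>To first order in \<open>\<eta>\<close>, the norm of \<open>x + \<eta> z\<close> stays \<open>1\<close>, because \<open>x\<close> is orthogonal to \<open>z\<close>. Hence a functional with value \<open>1\<close> at both \<open>x\<close> and \<open>z\<close> has norm greater than \<open>1\<close>.\<close>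
lemma orthogonal_sum_exceeds_sphere:
  assumes p: "1 < p" and x: "lp_pow p x = 1" and xz: "lp_dual p x \<bullet> z = 0"
  obtains \<eta> where "0 < \<eta>" "lp_pow p (x + \<eta> *\<^sub>R z) < (1 + \<eta>) powr p"
proof -
  have "\<forall>\<^sub>F c in at_right 0. lp_dual p (x + c *\<^sub>R z) \<bullet> z < 1"
    by (rule order_tendstoD(2)[OF lp_dual_at_right[OF p]]) (simp add: xz)
  then have "\<forall>\<^sub>F c in at_right 0. lp_dual p (x + c *\<^sub>R z) \<bullet> z < 1 \<and> 0 < c"
    by (intro eventually_conj eventually_at_right_less)
  then obtain \<eta> where \<eta>: "lp_dual p (x + \<eta> *\<^sub>R z) \<bullet> z < 1" "0 < \<eta>"
    using eventually_happens'[OF trivial_limit_at_right_real] by blast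
  have "lp_pow p (x + \<eta> *\<^sub>R z) \<le> 1 + p * (\<eta> * (lp_dual p (x + \<eta> *\<^sub>R z) \<bullet> z))"
    using lp_pow_tangent_above[OF p, of x "\<eta> *\<^sub>R z"] x by simp
  also have "\<dots> < 1 + p * (\<eta> * 1)"
    using \<eta> p by (intro add_strict_left_mono mult_strict_left_mono) auto
  also have "\<dots> < (1 + \<eta>) powr p"
    using bernoulli_powr_strict[OF p, of "1 + \<eta>"] \<eta> by simp
  finally show ?thesis using \<eta>(2) by (intro that)
qed

text \<open>Coordinatewise, \<open>c v + d u\<close> is dominated by \<open>\<bar>v\<bar> + \<epsilon> \<bar>u\<bar>\<close>, whose power sum tends to that of \<open>v\<close>. This gives one \<open>\<epsilon>\<close> that serves all \<open>c\<close> and \<open>d\<close>.\<close>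
lemma lp_pow_perturbation:
  assumes p: "1 < p" and "lp_pow p v < K"
  obtains \<epsilon> where "0 < \<epsilon>" "\<And>c d. \<bar>c\<bar> \<le> 1 \<Longrightarrow> \<bar>d\<bar> \<le> \<epsilon> \<Longrightarrow> lp_pow p (c *\<^sub>R v + d *\<^sub>R u) < K"
proof -
  define G where "G e = (\<bar>v $ 1\<bar> + e * \<bar>u $ 1\<bar>) powr p + (\<bar>v $ 2\<bar> + e * \<bar>u $ 2\<bar>) powr p" for e
  have "continuous_on {0..} G"
    unfolding G_def using p by (intro continuous_intros continuous_on_powr') auto
  then have "(G \<longlongrightarrow> G 0) (at 0 within {0..})"
    by (simp add: continuous_on_def)
  then have "(G \<longlongrightarrow> G 0) (at_right 0)"
    by (rule tendsto_within_subset) auto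
  moreover have "G 0 < K" using assms(2) by (simp add: G_def lp_pow_def)
  ultimately have "\<forall>\<^sub>F e in at_right 0. G e < K \<and> 0 < e"
    by (intro eventually_conj eventually_at_right_less order_tendstoD(2))
  then obtain \<epsilon> where e: "G \<epsilon> < K" "0 < \<epsilon>"
    using eventually_happens'[OF trivial_limit_at_right_real] by blast
  show ?thesis
  proof (rule that[OF e(2)])
    fix c d :: real assume c: "\<bar>c\<bar> \<le> 1" and d: "\<bar>d\<bar> \<le> \<epsilon>"
    have "\<bar>(c *\<^sub>R v + d *\<^sub>R u) $ i\<bar> \<le> \<bar>v $ i\<bar> + \<epsilon> * \<bar>u $ i\<bar>" for i
    proof -
      have "\<bar>(c *\<^sub>R v + d *\<^sub>R u) $ i\<bar> \<le> \<bar>c\<bar> * \<bar>v $ i\<bar> + \<bar>d\<bar> * \<bar>u $ i\<bar>"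
        by (simp add: abs_mult[symmetric] abs_triangle_ineq)
      also have "\<dots> \<le> 1 * \<bar>v $ i\<bar> + \<epsilon> * \<bar>u $ i\<bar>"
        using c d by (intro add_mono mult_right_mono) auto
      finally show ?thesis by simp
    qed
    then have "lp_pow p (c *\<^sub>R v + d *\<^sub>R u) \<le> G \<epsilon>"
      unfolding lp_pow_def G_def using p by (intro add_mono powr_mono2) auto
    with e show "lp_pow p (c *\<^sub>R v + d *\<^sub>R u) < K" by simp
  qed
qed

text \<open>Mutual orthogonality makes \<open>lp_dual p x\<close> and \<open>lp_dual p z\<close> the basis dual to \<open>x\<close>, \<open>z\<close>, and makes the coordinate along \<open>x\<close> a functional of norm \<open>1\<close>; exchanging \<open>x\<close> and \<open>z\<close> gives the same for the other coordinate.\<close>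
lemma mutually_orthogonal_coordinates:
  assumes p: "1 < p" and x: "lp_pow p x = 1" and z: "lp_pow p z = 1"
    and xz: "lp_dual p x \<bullet> z = 0" and zx: "lp_dual p z \<bullet> x = 0"
  shows "y = (lp_dual p x \<bullet> y) *\<^sub>R x + (lp_dual p z \<bullet> y) *\<^sub>R z"
    and "\<bar>lp_dual p x \<bullet> y\<bar> powr p \<le> lp_pow p y"
proof -
  have "x \<noteq> 0" using x by auto
  obtain d where d: "y = (lp_dual p z \<bullet> y) *\<^sub>R z + d *\<^sub>R x"
    using left_orthogonal_decomposition[OF z \<open>x \<noteq> 0\<close> zx] by blast
  have "lp_dual p x \<bullet> y = d"
    using arg_cong[OF d, of "\<lambda>w. lp_dual p x \<bullet> w"] x xz by (simp add: inner_add_right lp_dual_inner_self)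
  with d show eq: "y = (lp_dual p x \<bullet> y) *\<^sub>R x + (lp_dual p z \<bullet> y) *\<^sub>R z"
    by (simp add: add.commute)
  show "\<bar>lp_dual p x \<bullet> y\<bar> powr p \<le> lp_pow p y"
    using lp_pow_tangent[OF p, of "(lp_dual p x \<bullet> y) *\<^sub>R x" "(lp_dual p z \<bullet> y) *\<^sub>R z"] x xz
    by (simp add: eq[symmetric] lp_dual_scaleR lp_pow_scaleR)
qed

section \<open>Left symmetric operators\<close>
definition rank_one :: "real^2 \<Rightarrow> real^2 \<Rightarrow> (real^2) \<Rightarrow>\<^sub>L (real^2)" where
  "rank_one w f = blinfun_scaleR_left w o\<^sub>L blinfun_inner_right f"

lemma rank_one_apply [simp]: "rank_one w f y = (f \<bullet> y) *\<^sub>R w"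
  by (simp add: rank_one_def)

text \<open>The test operator \<open>A\<close> of rank one agrees with \<open>T\<close> at \<open>z\<close> and vanishes at \<open>x\<close>. Its value at \<open>c z + d x\<close> depends on \<open>c\<close> alone, so its norming points are only \<open>\<plusminus>z\<close>, as \<open>lp_pow\<close> is strictly smaller at \<open>c z\<close> than elsewhere on the line through \<open>c z\<close> in the direction \<open>x\<close>. So \<open>A\<close> is orthogonal to \<open>T\<close> only if \<open>T z\<close> is orthogonal to itself.\<close>
lemma left_symmetric_kills_left_orthogonal:
  fixes T :: "(real^2) \<Rightarrow>\<^sub>L (real^2)"
  assumes p: "1 < p" and sym: "left_symmetric (lp_opnorm p) T" and x: "lp_norming p T x"
    and z: "lp_pow p z = 1" and zx: "lp_dual p z \<bullet> x = 0"
  shows "T z = 0"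
proof (rule ccontr)
  assume Tz: "T z \<noteq> 0"
  have x0: "x \<noteq> 0" using x by (auto simp: lp_norming_def)
  define A where "A = rank_one (T z) (lp_dual p z)"
  have A: "A y = (lp_dual p z \<bullet> y) *\<^sub>R T z" for y by (simp add: A_def)
  have "bj_orthogonal (lp_opnorm p) T A"
    by (rule bj_orthogonalI_norming[OF p x]) (simp add: A zx)
  then have "bj_orthogonal (lp_opnorm p) A T"
    using sym by (simp add: left_symmetric_def)
  then obtain y where y: "lp_norming p A y" and neg: "lp_dual p (A y) \<bullet> T y \<le> 0"
    using bj_orthogonalD_norming'[OF p] by blast
  define c where "c = lp_dual p z \<bullet> y"
  have "lp_pow p (A z) \<le> lp_pow p (A y)"
    using y z by (simp add: lp_norming_def)
  then have c1: "1 \<le> \<bar>c\<bar> powr p"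
    using z lp_pow_pos[OF Tz, of p] by (simp add: A c_def lp_pow_scaleR lp_dual_inner_self)
  obtain d where d: "y = c *\<^sub>R z + d *\<^sub>R x"
    using left_orthogonal_decomposition[OF z x0 zx] unfolding c_def by blast
  have "d = 0"
  proof (rule ccontr)
    assume "d \<noteq> 0"
    then have "lp_pow p (c *\<^sub>R z) < lp_pow p y"
      using lp_pow_tangent_strict[OF p, of "d *\<^sub>R x" "c *\<^sub>R z"] x0 zx
      by (simp add: d lp_dual_scaleR)
    then show False using c1 z y by (simp add: lp_pow_scaleR lp_norming_def)
  qed
  then have "lp_dual p (A y) \<bullet> T y = \<bar>c\<bar> powr p * lp_pow p (T z)"
    using lp_dual_scaleR_inner_scaleR[of p c "T z" "T z"]
    by (simp add: A c_def[symmetric]) (simp add: d blinfun.scaleR_right lp_dual_inner_self)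
  then show False
    using neg c1 lp_pow_pos[OF Tz, of p] by (smt (verit) mult_pos_pos)
qed

text \<open>Moving from \<open>x\<close> in a direction of the kernel does not change the image, so it cannot decrease the norm of \<open>x\<close>, or else the normalized point would beat the norming point \<open>x\<close>.\<close>
lemma norming_right_orthogonal_kernel:
  fixes T :: "(real^2) \<Rightarrow>\<^sub>L (real^2)"
  assumes p: "1 < p" and x: "lp_norming p T x" and "T x \<noteq> 0" and Tz: "T z = 0"
  shows "lp_dual p x \<bullet> z = 0"
proof (rule lp_dual_orthogonalI[OF p])
  fix c
  have "lp_pow p (T x) * 1 \<le> lp_pow p (T x) * lp_pow p (x + c *\<^sub>R z)"
    using lp_norming_bound[OF p x, of "x + c *\<^sub>R z"] Tz
    by (simp add: blinfun.add_right blinfun.scaleR_right)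
  then show "lp_pow p x \<le> lp_pow p (x + c *\<^sub>R z)"
    using lp_pow_pos[OF assms(3), of p] x by (simp add: lp_norming_def)
qed

text \<open>With \<open>A y = (lp_dual p x \<bullet> y) v\<close> the slope \<open>lp_dual p (A y) \<bullet> T y\<close> is a positive multiple of \<open>lp_dual p v \<bullet> u\<close> at every norming point of \<open>A\<close>, so the two one-sided conditions for orthogonality of \<open>A\<close> to \<open>T\<close> bound the same number from both sides.\<close>
lemma left_symmetric_range_orthogonal:
  fixes T :: "(real^2) \<Rightarrow>\<^sub>L (real^2)"
  assumes p: "1 < p" and sym: "left_symmetric (lp_opnorm p) T" and x: "lp_norming p T x"
    and T: "\<And>y. T y = (lp_dual p x \<bullet> y) *\<^sub>R u"
    and v: "v \<noteq> 0" and uv: "lp_dual p u \<bullet> v = 0"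
  shows "lp_dual p v \<bullet> u = 0"
proof -
  define A where "A = rank_one v (lp_dual p x)"
  have A: "A y = (lp_dual p x \<bullet> y) *\<^sub>R v" for y by (simp add: A_def)
  have xx: "lp_dual p x \<bullet> x = 1" and x1: "lp_pow p x = 1"
    using x by (simp_all add: lp_dual_inner_self lp_norming_def)
  have "bj_orthogonal (lp_opnorm p) T A"
    by (rule bj_orthogonalI_norming[OF p x]) (simp add: A T xx uv)
  then have bj: "bj_orthogonal (lp_opnorm p) A T"
    using sym by (simp add: left_symmetric_def)
  have dual: "\<exists>t>0. lp_dual p (A y) \<bullet> T y = t * (lp_dual p v \<bullet> u)" if y: "lp_norming p A y" for y
  proof -
    have "lp_pow p (A x) \<le> lp_pow p (A y)" using y x1 by (simp add: lp_norming_def)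
    then have "1 \<le> \<bar>lp_dual p x \<bullet> y\<bar> powr p"
      using lp_pow_pos[OF v, of p] by (simp add: A xx lp_pow_scaleR)
    then show ?thesis
      by (intro exI[of _ "\<bar>lp_dual p x \<bullet> y\<bar> powr p"])
        (auto simp add: A T lp_dual_scaleR_inner_scaleR simp del: inner_scaleR_right)
  qed
  obtain y where "lp_norming p A y" "0 \<le> lp_dual p (A y) \<bullet> T y"
    using bj_orthogonalD_norming[OF p bj] .
  then have "0 \<le> lp_dual p v \<bullet> u" using dual[of y] by (auto simp: zero_le_mult_iff)
  moreover obtain y where "lp_norming p A y" "lp_dual p (A y) \<bullet> T y \<le> 0"
    using bj_orthogonalD_norming'[OF p bj] .
  then have "lp_dual p v \<bullet> u \<le> 0" using dual[of y] by (auto simp: mult_le_0_iff)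
  ultimately show ?thesis by simp
qed

lemma left_symmetric_imp_zero:
  fixes T :: "(real^2) \<Rightarrow>\<^sub>L (real^2)"
  assumes p: "1 < p" and sym: "left_symmetric (lp_opnorm p) T"
  shows "T = 0"
proof (rule ccontr)
  assume T0: "T \<noteq> 0"
  obtain x where x: "lp_norming p T x" using lp_norming_exists[OF p] by blast
  then have x1: "lp_pow p x = 1" by (simp add: lp_norming_def)
  then have x0: "x \<noteq> 0" by auto
  define u where "u = T x"
  have u0: "u \<noteq> 0"
  proof
    assume "u = 0"
    then have "T y = 0" for y
      using lp_norming_bound[OF p x, of y] lp_pow_pos[of "T y" p] by (force simp: u_def)
    then show False using T0 by (auto intro: blinfun_eqI)
  qed
  obtain z where z: "lp_pow p z = 1" and zx: "lp_dual p z \<bullet> x = 0"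
    using lp_left_orthogonal_exists[OF p x0] .
  have Tz: "T z = 0"
    by (rule left_symmetric_kills_left_orthogonal[OF p sym x z zx])
  have xz: "lp_dual p x \<bullet> z = 0"
    using norming_right_orthogonal_kernel[OF p x _ Tz] u0 by (simp add: u_def)
  note coords = mutually_orthogonal_coordinates[OF p x1 z xz zx]
  note coords' = mutually_orthogonal_coordinates[OF p z x1 zx xz]
  have T: "T y = (lp_dual p x \<bullet> y) *\<^sub>R u" for y
    using arg_cong[OF coords(1)[of y], of T] Tz
    by (simp add: blinfun.add_right blinfun.scaleR_right u_def)
  obtain v where v: "v \<noteq> 0" and uv: "lp_dual p u \<bullet> v = 0"
    using lp_right_orthogonal_exists[OF u0] by metis
  have vu: "lp_dual p v \<bullet> u = 0"
    by (rule left_symmetric_range_orthogonal[OF p sym x T v uv])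
  have vpos: "0 < lp_pow p v" by (rule lp_pow_pos[OF v])

  obtain \<eta> where \<eta>: "0 < \<eta>" "lp_pow p (x + \<eta> *\<^sub>R z) < (1 + \<eta>) powr p"
    using orthogonal_sum_exceeds_sphere[OF p x1 xz] .
  define q where "q = x + \<eta> *\<^sub>R z"
  have q: "lp_dual p x \<bullet> q = 1" "lp_dual p z \<bullet> q = \<eta>"
    using x1 z xz zx by (simp_all add: q_def inner_add_right lp_dual_inner_self)
  have qpos: "0 < lp_pow p q" using q by (intro lp_pow_pos) auto
  \<comment> \<open>Up to the term in \<open>u\<close>, \<open>K\<close> is the power of the norm of \<open>A\<close> at the normalized \<open>q\<close>, for the operator \<open>A\<close> below.\<close>
  define K where "K = (1 + \<eta>) powr p / lp_pow p q * lp_pow p v"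
  have "1 * lp_pow p v < K"
    unfolding K_def using \<eta> qpos vpos by (intro mult_strict_right_mono) (auto simp: q_def)
  then obtain \<epsilon> where \<epsilon>: "0 < \<epsilon>"
      and small: "\<And>c d. \<bar>c\<bar> \<le> 1 \<Longrightarrow> \<bar>d\<bar> \<le> \<epsilon> \<Longrightarrow> lp_pow p (c *\<^sub>R v + d *\<^sub>R u) < K"
    using lp_pow_perturbation[OF p] by (metis mult_1)

  define A where "A = rank_one v (lp_dual p x + lp_dual p z) + \<epsilon> *\<^sub>R rank_one u (lp_dual p z)"
  have A: "A y = (lp_dual p x \<bullet> y + lp_dual p z \<bullet> y) *\<^sub>R v + (\<epsilon> * (lp_dual p z \<bullet> y)) *\<^sub>R u" for y
    by (simp add: A_def blinfun.add_left blinfun.scaleR_left inner_add_left)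
  have "bj_orthogonal (lp_opnorm p) T A"
    by (rule bj_orthogonalI_norming[OF p x])
      (simp add: A zx uv x1 lp_dual_inner_self flip: u_def)
  then have "bj_orthogonal (lp_opnorm p) A T"
    using sym by (simp add: left_symmetric_def)
  then obtain y where y: "lp_norming p A y" and neg: "lp_dual p (A y) \<bullet> T y \<le> 0"
    using bj_orthogonalD_norming'[OF p] by blast
  have y1: "lp_pow p y = 1" using y by (simp add: lp_norming_def)
  define g h where "g = lp_dual p x \<bullet> y" and "h = lp_dual p z \<bullet> y"
  have gh: "\<bar>g\<bar> \<le> 1" "\<bar>h\<bar> \<le> 1"
    using coords(2)[of y] coords'(2)[of y] p gr_one_powr[of "\<bar>g\<bar>" p] gr_one_powr[of "\<bar>h\<bar>" p]
    by (auto simp: y1 g_def h_def not_le[symmetric])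
  \<comment> \<open>Where \<open>g\<close> and \<open>h\<close> have the same strict sign, the slope of the norm of \<open>A y\<close> along \<open>T y\<close> is positive.\<close>
  have "g * h \<le> 0"
  proof (rule ccontr)
    assume "\<not> g * h \<le> 0"
    then have pos: "0 < g * h" and h0: "h \<noteq> 0" by auto
    have "0 < \<epsilon> * (h * (lp_dual p (A y) \<bullet> u))"
      using lp_dual_orthogonal_sign[OF p u0 vu, of "\<epsilon> * h" "g + h"] \<epsilon> h0
      by (simp add: A g_def h_def mult.assoc)
    then have "0 < h * (lp_dual p (A y) \<bullet> u)"
      using \<epsilon> by (simp only: zero_less_mult_pos)
    with pos have "0 < g * (lp_dual p (A y) \<bullet> u)"
      by (auto simp: zero_less_mult_iff)
    with neg show False by (simp add: T g_def)
  qed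
  then have "\<bar>g + h\<bar> \<le> 1"
    using gh by (auto simp: mult_le_0_iff)
  moreover have "\<bar>\<epsilon> * h\<bar> \<le> \<epsilon>"
    using \<epsilon> gh(2) by (simp add: abs_mult)
  ultimately have "lp_pow p (A y) < K"
    using small by (simp add: A g_def h_def)
  moreover have "K \<le> lp_pow p (A y)"
  proof -
    have "(1 + \<eta>) powr p * lp_pow p v \<le> lp_pow p (A q)"
      using lp_pow_tangent[OF p, of "(1 + \<eta>) *\<^sub>R v" "(\<epsilon> * \<eta>) *\<^sub>R u"] vu \<eta>(1)
      by (simp add: A q lp_dual_scaleR lp_pow_scaleR)
    also have "\<dots> \<le> lp_pow p (A y) * lp_pow p q"
      by (rule lp_norming_bound[OF p y])
    finally show ?thesis using qpos by (simp add: K_def field_simps)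
  qed
  ultimately show False by simp
qed

lemma left_symmetric_zero: "left_symmetric (lp_opnorm p) 0"
  unfolding left_symmetric_def bj_orthogonal_def by simp

theorem theorem2p10:
  fixes p :: real and T :: "(real^2) \<Rightarrow>\<^sub>L (real^2)"
  assumes "2 \<le> p"
  shows "left_symmetric (lp_opnorm p) T \<longleftrightarrow> T = 0"
  using left_symmetric_imp_zero[of p T] left_symmetric_zero[of p] assms by auto

end
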